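(* Let $\boldsymbol{\Lambda}_k$ be an $MN_k\times MN_k$ diagonal matrix with nonnegative diagonal entries, and let $M_e,N_e$ be positive integers with $M_eN_e\le MN_k$. Consider the secret key rate $$R_k(\mathbf{U}_k)=-\log\det\left(\mathbf{I}-\left(\boldsymbol{\Lambda}_k^{1/2}\mathbf{U}_k\left(\mathbf{I}+\mathbf{U}_k^H\boldsymbol{\Lambda}_k\mathbf{U}_k\right)^{-1}\mathbf{U}_k^H\boldsymbol{\Lambda}_k^{1/2}\right)^2\right)$$ as a function of $\mathbf{U}_k\in\mathbb{C}^{MN_k\times M_eN_e}$ subject to $\mathbf{U}_k^H\mathbf{U}_k=\mathbf{I}$. Then $R_k$ is maximized, over all such $\mathbf{U}_k$, by $$\mathbf{U}_k=\begin{bmatrix}\mathbf{e}_{\eta_1}&\mathbf{e}_{\eta_2}&\cdots&\mathbf{e}_{\eta_{M_eN_e}}\end{bmatrix},$$ where $\mathbf{e}_i$ is the $i$th standard unit column vector of $\mathbb{C}^{MN_k}$ and $\eta_i$ is the index (diagonal position) of the $i$th largest eigenvalue of the diagonal matrix $\boldsymbol{\Lambda}_k(\mathbf{I}+\boldsymbol{\Lambda}_k)^{-1}$ (with $\eta_1,\eta_2,\dots$ distinct, eigenvalues counted with multiplicity). The optimal rate is $$R_k=-\sum_{i=1}^{M_eN_e}\log\lambda_i\Big(\mathbf{I}-\boldsymbol{\Lambda}_k^{2}(\mathbf{I}+\boldsymbol{\Lambda}_k)^{-2}\Big),$$ where $\lambda_i(\cdot)$ here denotes the $i$th smallest eigenvalue,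 counted with multiplicity (equivalently, the eigenvalue at diagonal position $\eta_i$).
   Context: $(\cdot)^H$ denotes conjugate transpose and $\mathbf{I}$ an identity matrix of appropriate size. $\boldsymbol{\Lambda}_k$ is the full correlation matrix $\mathbb{E}\{\mathrm{vec}(\tilde{\mathbf{H}}_k)\mathrm{vec}(\tilde{\mathbf{H}}_k)^H\}$ of the $N_k\times M$ beam domain channel matrix $\tilde{\mathbf{H}}_k$ of user terminal $k$, whose entries are statistically independent, so that $\boldsymbol{\Lambda}_k$ is diagonal. $\boldsymbol{\Lambda}_k^{1/2}$ is its positive semidefinite square root. $M_e$ and $N_e$ are the reduced channel dimensions at the base station and at the user terminal. *)

theory Defs
  imports
    "Jordan_Normal_Form.Schur_Decomposition"
    "Jordan_Normal_Form.Gauss_Jordan_Elimination"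
    "Jordan_Normal_Form.Char_Poly"
    "HOL-Computational_Algebra.Fundamental_Theorem_Algebra"
    "HOL-Library.Nonpos_Ints"
    "HOL-Library.Multiset"
begin

text \<open>Used for square invertible matrices only; otherwise the value is unspecified.\<close>

definition minv :: "complex mat \<Rightarrow> complex mat" where
  "minv A = the (mat_inverse A)"

text \<open>The order on the complex numbers makes \<open>0 \<le> z\<close> say that z is real and nonnegative.\<close>

definition psd :: "complex mat \<Rightarrow> bool" where
  "psd A \<longleftrightarrow> square_mat A \<and> mat_adjoint A = A \<and>
     (\<forall>v \<in> carrier_vec (dim_row A). 0 \<le> (A *\<^sub>v v) \<bullet>c v)"

text \<open>The unique positive semidefinite square root of a positive semidefinite matrix.\<close>

definition psd_sqrt :: "complex mat \<Rightarrow> complex mat" where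
  "psd_sqrt A = (THE B. psd B \<and> B ^\<^sub>m 2 = A)"

text \<open>
  The eigenvalues of a matrix with real spectrum, in increasing order and repeated according
  to multiplicity.  Positions in the list are counted from 0.
\<close>

definition real_eigvals :: "complex mat \<Rightarrow> real list" where
  "real_eigvals A = sorted_list_of_multiset (image_mset Re (proots (char_poly A)))"

definition nth_smallest_eigval :: "complex mat \<Rightarrow> nat \<Rightarrow> real" where
  "nth_smallest_eigval A i = real_eigvals A ! i"

definition nth_largest_eigval :: "complex mat \<Rightarrow> nat \<Rightarrow> real" where
  "nth_largest_eigval A i = rev (real_eigvals A) ! i"

text \<open>
  The secret key rate with logarithm to base b, for a correlation matrix L of size n and a matrix U
  with r columns.  The determinant is that of a Hermitian matrix, so \<open>Re\<close> only changes its type.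
\<close>

definition key_rate :: "real \<Rightarrow> complex mat \<Rightarrow> complex mat \<Rightarrow> real" where
  "key_rate b L U =
    (let n = dim_row L; r = dim_col U; S = psd_sqrt L in
     - log b (Re (det (1\<^sub>m n -
         (S * U * minv (1\<^sub>m r + mat_adjoint U * L * U) * mat_adjoint U * S) ^\<^sub>m 2))))"

definition unit_cols :: "nat \<Rightarrow> nat \<Rightarrow> (nat \<Rightarrow> nat) \<Rightarrow> complex mat" where
  "unit_cols n r \<eta> = mat_of_cols n (map (\<lambda>i. unit_vec n (\<eta> i)) [0..<r])"

end

theory Submission
  imports Defs
begin

text \<open>
  Write \<open>G = U\<^sup>H \<Lambda> U\<close>. Sylvester's identity \<open>det (I + A B) = det (I + B A)\<close> turns the determinant
  in the key rate into \<open>det (I + 2 G) / det (I + G)\<^sup>2\<close>. By the Cauchy--Binet formula,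
  \<open>det (U\<^sup>H D U) = (\<Sum>T. w T * (\<Prod>i\<in>T. d i))\<close> for every diagonal \<open>D\<close>, where the weights
  \<open>w T = |det U\<^sub>T|\<^sup>2\<close> do not depend on \<open>D\<close> and sum to 1 since U is an isometry.
  Let c be the product of the r smallest values of \<open>(1 + 2 \<Lambda>\<^sub>i) / (1 + \<Lambda>\<^sub>i)\<^sup>2\<close>, and put
  \<open>a T = (\<Prod>i\<in>T. 1 + \<Lambda>\<^sub>i)\<close> and \<open>b T = (\<Prod>i\<in>T. 1 + 2 \<Lambda>\<^sub>i)\<close>. Then \<open>b T \<ge> c (a T)\<^sup>2\<close> for all T, so
  \<open>det (I + 2 G) = (\<Sum>T. w T * b T) \<ge> c (\<Sum>T. w T * (a T)\<^sup>2) \<ge> c (\<Sum>T. w T * a T)\<^sup>2 = c (det (I + G))\<^sup>2\<close>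
  by convexity, with equality when the columns of U are the corresponding unit vectors.
\<close>

section \<open>Sylvester's determinant identity\<close>

text \<open>The block matrices \<open>?L\<close> and \<open>?R\<close> multiply to a block lower
  triangular matrix in either order. One order has diagonal blocks \<open>1 + A * B\<close> and
  \<open>1\<close>, the other \<open>1\<close> and \<open>1 + B * A\<close>, and both products have
  the same determinant.\<close>

lemma det_one_plus_mult_comm:
  fixes A :: "'a :: idom mat"
  assumes A: "A \<in> carrier_mat n r" and B: "B \<in> carrier_mat r n"
  shows "det (1\<^sub>m n + A * B) = det (1\<^sub>m r + B * A)"
proof -
  let ?L = "four_block_mat (1\<^sub>m n) (- A) B (1\<^sub>m r)"
  let ?R = "four_block_mat (1\<^sub>m n) A (0\<^sub>m r n) (1\<^sub>m r)"
  have L: "?L \<in> carrier_mat (n + r) (n + r)" and R: "?R \<in> carrier_mat (n + r) (n + r)"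
    by auto
  have "?R * ?L = four_block_mat (1\<^sub>m n + A * B) (0\<^sub>m n r) B (1\<^sub>m r)"
    by (subst mult_four_block_mat[OF one_carrier_mat A zero_carrier_mat one_carrier_mat
            one_carrier_mat uminus_carrier_mat[OF A] B one_carrier_mat])
      (use A B in \<open>auto intro!: arg_cong2[where f = "\<lambda>X Y. four_block_mat X Y B (1\<^sub>m r)"]\<close>)
  then have RL: "det (?R * ?L) = det (1\<^sub>m n + A * B)"
    using det_four_block_mat_upper_right_zero[of "1\<^sub>m n + A * B" n "0\<^sub>m n r" r B "1\<^sub>m r"] A B
    by simp
  have "?L * ?R = four_block_mat (1\<^sub>m n) (0\<^sub>m n r) B (1\<^sub>m r + B * A)"
    by (subst mult_four_block_mat[OF one_carrier_mat uminus_carrier_mat[OF A] B one_carrier_mat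
            one_carrier_mat A zero_carrier_mat one_carrier_mat])
      (use A B in \<open>auto intro!: arg_cong2[where f = "\<lambda>X Y. four_block_mat (1\<^sub>m n) X B Y"] comm_add_mat\<close>)
  then have LR: "det (?L * ?R) = det (1\<^sub>m r + B * A)"
    using det_four_block_mat_upper_right_zero[of "1\<^sub>m n" n "0\<^sub>m n r" r B "1\<^sub>m r + B * A"] A B
    by simp
  show ?thesis using RL LR det_mult[OF L R] det_mult[OF R L] by (simp add: mult.commute)
qed

section \<open>The Cauchy--Binet formula with a diagonal matrix in the middle\<close>

text \<open>
  Cauchy--Binet is stated with index functions instead of r-element subsets: every subset is hit by
  \<open>r!\<close> injective functions, and the minors of the other functions vanish. The functions are the
  identity beyond r so that there are finitely many of them.
\<close>

definition index_funs :: "nat \<Rightarrow> nat \<Rightarrow> (nat \<Rightarrow> nat) set" where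
  "index_funs r n = {f. (\<forall>i\<in>{0..<r}. f i \<in> {0..<n}) \<and> (\<forall>i. i \<notin> {0..<r} \<longrightarrow> f i = i)}"

definition row_minor :: "'a :: comm_ring_1 mat \<Rightarrow> (nat \<Rightarrow> nat) \<Rightarrow> 'a" where
  "row_minor A f = det (mat (dim_col A) (dim_col A) (\<lambda>(i, j). A $$ (f i, j)))"

text \<open>Permuting the arguments below \<open>r\<close> leaves the identity beyond
  \<open>r\<close> intact, so sums over index functions may be reindexed by
  \<open>f \<circ> p\<close>.\<close>

lemma index_funs_permute:
  assumes p: "p permutes {0..<r}"
  shows "bij_betw (\<lambda>f. f \<circ> p) (index_funs r n) (index_funs r n)"
proof (rule bij_betw_byWitness[where f' = "\<lambda>f. f \<circ> inv_into UNIV p"])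
  have *: "(\<lambda>f. f \<circ> q) ` index_funs r n \<subseteq> index_funs r n" if "q permutes {0..<r}" for q
    using permutes_in_image[OF that] permutes_not_in[OF that]
    by (auto simp: index_funs_def)
  show "(\<lambda>f. f \<circ> p) ` index_funs r n \<subseteq> index_funs r n"
    "(\<lambda>f. f \<circ> inv_into UNIV p) ` index_funs r n \<subseteq> index_funs r n"
    using * p permutes_inv[OF p] by auto
qed (simp_all add: o_assoc[symmetric] permutes_inv_o[OF p])

lemma row_minor_permute:
  assumes A: "A \<in> carrier_mat n r" and p: "p permutes {0..<r}"
  shows "row_minor A (f \<circ> p) = signof p * row_minor A f"
proof -
  have "mat r r (\<lambda>(i, j). A $$ ((f \<circ> p) i, j)) =
      mat r r (\<lambda>(i, j). mat r r (\<lambda>(i, j). A $$ (f i, j)) $$ (p i, j))"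
    using permutes_in_image[OF p, unfolded atLeastLessThan_iff] by (intro eq_matI) auto
  then show ?thesis
    using det_permute_rows[of "mat r r (\<lambda>(i, j). A $$ (f i, j))" r p] A p
    by (simp add: row_minor_def)
qed

lemma row_minor_not_inj:
  assumes A: "A \<in> carrier_mat n r" and f: "\<not> inj_on f {0..<r}"
  shows "row_minor A f = 0"
proof -
  from f obtain i j where ij: "i < r" "j < r" "i \<noteq> j" "f i = f j"
    by (auto simp: inj_on_def)
  show ?thesis unfolding row_minor_def
    by (rule det_identical_rows[of _ r i j]) (use A ij in \<open>auto intro!: eq_vecI\<close>)
qed

text \<open>Each row of the product is a linear combination of the rows of \<open>A\<close>.
  Multilinearity of the determinant expands it over all ways \<open>f\<close> of choosing one row of
  \<open>A\<close> for each position.\<close>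

lemma det_mult_diag_mult:
  fixes A :: "'a :: comm_ring_1 mat"
  assumes B: "B \<in> carrier_mat r n" and A: "A \<in> carrier_mat n r"
  shows "det (B * mat_diag n d * A) =
    (\<Sum>f\<in>index_funs r n. (\<Prod>i<r. d (f i)) * (\<Prod>i<r. B $$ (i, f i)) * row_minor A f)"
proof -
  let ?C = "B * mat_diag n d"
  have C: "?C \<in> carrier_mat r n" using B by auto
  have Cij: "?C $$ (i, k) = B $$ (i, k) * d k" if "i < r" "k < n" for i k
    using that by (simp add: mat_diag_mult_right[OF B])
  have "det (?C * A) = (\<Sum>f\<in>index_funs r n. det (mat\<^sub>r r r (\<lambda>i. ?C $$ (i, f i) \<cdot>\<^sub>v row A (f i))))"
    unfolding mat_mul_finsum_alt[OF C A] index_funs_def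
    by (rule det_linear_rows_sum) (use A in auto)
  also have "\<dots> = (\<Sum>f\<in>index_funs r n. (\<Prod>i<r. d (f i)) * (\<Prod>i<r. B $$ (i, f i)) * row_minor A f)"
  proof (rule sum.cong[OF refl])
    fix f assume f: "f \<in> index_funs r n"
    have "mat\<^sub>r r r (\<lambda>i. row A (f i)) = mat r r (\<lambda>(i, j). A $$ (f i, j))"
      using A f by (intro eq_matI) (auto simp: index_funs_def)
    moreover have "(\<Prod>i\<in>{0..<r}. ?C $$ (i, f i)) = (\<Prod>i<r. d (f i)) * (\<Prod>i<r. B $$ (i, f i))"
      unfolding prod.distrib[symmetric] lessThan_atLeast0
      by (rule prod.cong) (use f Cij in \<open>auto simp: index_funs_def mult.commute\<close>)
    ultimately show "det (mat\<^sub>r r r (\<lambda>i. ?C $$ (i, f i) \<cdot>\<^sub>v row A (f i))) =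
        (\<Prod>i<r. d (f i)) * (\<Prod>i<r. B $$ (i, f i)) * row_minor A f"
      using A by (subst det_rows_mul) (auto simp: row_minor_def)
  qed
  finally show ?thesis .
qed

text \<open>The previous expansion is asymmetric: it has a plain product of entries of
  \<open>B\<close> but a minor of \<open>A\<close>. Summing it over all \<open>r!\<close>
  reindexings by permutations assembles the products into the Leibniz formula for a minor of
  \<open>B\<close>; the transpose is there because \<open>B\<close> is sampled by columns.\<close>

lemma cauchy_binet_diag:
  fixes A :: "'a :: comm_ring_1 mat"
  assumes B: "B \<in> carrier_mat r n" and A: "A \<in> carrier_mat n r"
  shows "of_nat (fact r) * det (B * mat_diag n d * A) =
    (\<Sum>f\<in>index_funs r n. (\<Prod>i<r. d (f i)) * row_minor (transpose_mat B) f * row_minor A f)"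
proof -
  let ?P = "{p. p permutes {0..<r}}"
  \<comment> \<open>The product of the \<open>d (f i)\<close> is invariant under \<open>p\<close>;
    the sign that the minor of \<open>A\<close> picks up is moved to the entries of
    \<open>B\<close>.\<close>
  have perm: "det (B * mat_diag n d * A) =
      (\<Sum>f\<in>index_funs r n. (\<Prod>i<r. d (f i)) * (signof p * (\<Prod>i<r. B $$ (i, f (p i)))) * row_minor A f)"
    if p: "p permutes {0..<r}" for p
    unfolding det_mult_diag_mult[OF B A]
  proof (subst sum.reindex_bij_betw[OF index_funs_permute[OF p], symmetric], rule sum.cong[OF refl])
    fix f
    have "(\<Prod>i<r. d ((f \<circ> p) i)) = (\<Prod>i<r. d (f i))"
      using prod.permute[OF p, of "\<lambda>i. d (f i)"] by (simp add: lessThan_atLeast0 o_def)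
    then show "(\<Prod>i<r. d ((f \<circ> p) i)) * (\<Prod>i<r. B $$ (i, (f \<circ> p) i)) * row_minor A (f \<circ> p) =
        (\<Prod>i<r. d (f i)) * (signof p * (\<Prod>i<r. B $$ (i, f (p i)))) * row_minor A f"
      by (simp add: row_minor_permute[OF A p] mult_ac)
  qed
  have minor: "row_minor (transpose_mat B) f = (\<Sum>p\<in>?P. signof p * (\<Prod>i<r. B $$ (i, f (p i))))"
    if f: "f \<in> index_funs r n" for f
  proof -
    have "row_minor (transpose_mat B) f = det (transpose_mat (mat r r (\<lambda>(i, j). B $$ (i, f j))))"
      using B f by (auto simp: row_minor_def index_funs_def intro!: arg_cong[where f = det] eq_matI)
    also have "\<dots> = det (mat r r (\<lambda>(i, j). B $$ (i, f j)))"
      by (rule det_transpose) auto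
    also have "\<dots> = (\<Sum>p\<in>?P. signof p * (\<Prod>i<r. B $$ (i, f (p i))))"
      unfolding det_def'[OF mat_carrier] lessThan_atLeast0
      by (intro sum.cong refl arg_cong2[where f = "(*)"] prod.cong)
        (auto simp: permutes_in_image)
    finally show ?thesis .
  qed
  have "of_nat (fact r) * det (B * mat_diag n d * A) = (\<Sum>p\<in>?P. det (B * mat_diag n d * A))"
    by (simp add: card_permutations[of "{0..<r}" r])
  also have "\<dots> = (\<Sum>p\<in>?P. \<Sum>f\<in>index_funs r n.
      (\<Prod>i<r. d (f i)) * (signof p * (\<Prod>i<r. B $$ (i, f (p i)))) * row_minor A f)"
    by (intro sum.cong refl perm) simp
  also have "\<dots> = (\<Sum>f\<in>index_funs r n. (\<Prod>i<r. d (f i)) *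
      (\<Sum>p\<in>?P. signof p * (\<Prod>i<r. B $$ (i, f (p i)))) * row_minor A f)"
    by (subst sum.swap) (simp add: sum_distrib_left sum_distrib_right)
  finally show ?thesis using minor by simp
qed

section \<open>Adjoints, inverses and diagonal matrices\<close>

lemma mat_adjoint_carrier: "A \<in> carrier_mat n m \<Longrightarrow> mat_adjoint A \<in> carrier_mat m n"
  by (auto simp: mat_adjoint_def)

lemma mat_adjoint_index:
  "i < dim_col A \<Longrightarrow> j < dim_row A \<Longrightarrow> mat_adjoint A $$ (i, j) = conjugate (A $$ (j, i))"
  by (simp add: mat_adjoint_def mat_of_rows_index)

lemma pow_mat_two:
  fixes A :: "'a :: semiring_1 mat"
  shows "A \<in> carrier_mat n n \<Longrightarrow> A ^\<^sub>m 2 = A * A"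
  by (simp add: numeral_2_eq_2)

lemma minv_mult:
  assumes A: "A \<in> carrier_mat n n" and "det A \<noteq> 0"
  shows "A * minv A = 1\<^sub>m n" "minv A \<in> carrier_mat n n"
proof -
  obtain B where "mat_inverse A = Some B"
    using mat_inverse(1)[OF A] det_non_zero_imp_unit[OF A \<open>det A \<noteq> 0\<close>] by fastforce
  then show "A * minv A = 1\<^sub>m n" "minv A \<in> carrier_mat n n"
    using mat_inverse(2)[OF A] by (auto simp: minv_def)
qed

lemma minv_unique:
  assumes A: "A \<in> carrier_mat n n" and B: "B \<in> carrier_mat n n" and BA: "B * A = 1\<^sub>m n"
  shows "minv A = B"
proof -
  have "det B * det A = 1" using det_mult[OF B A] BA by simp
  then have "det A \<noteq> 0" by auto
  note C = minv_mult[OF A this]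
  have "B = B * (A * minv A)" using B C by simp
  also have "\<dots> = minv A" using assoc_mult_mat[OF B A C(2)] BA C(2) by simp
  finally show ?thesis by simp
qed

abbreviation rdiag :: "nat \<Rightarrow> (nat \<Rightarrow> real) \<Rightarrow> complex mat" where
  "rdiag n a \<equiv> mat_diag n (\<lambda>i. complex_of_real (a i))"

lemma mat_diag_cong: "(\<And>i. i < n \<Longrightarrow> f i = g i) \<Longrightarrow> mat_diag n f = mat_diag n g"
  by (auto simp: mat_diag_def)

lemma mat_diag_add: "mat_diag n f + mat_diag n g = mat_diag n (\<lambda>i. f i + g i :: 'a :: monoid_add)"
  by (auto simp: mat_diag_def)

lemma mat_diag_minus: "mat_diag n f - mat_diag n g = mat_diag n (\<lambda>i. f i - g i :: 'a :: group_add)"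
  by (auto simp: mat_diag_def)

lemma det_mat_diag: "det (mat_diag n d :: 'a :: comm_ring_1 mat) = (\<Prod>i<n. d i)"
proof -
  have "diag_mat (mat_diag n d) = map d [0..<n]"
    by (auto simp: diag_mat_def mat_diag_def)
  then show ?thesis
    using det_upper_triangular[of "mat_diag n d" n]
    by (simp add: mat_diag_def upper_triangular_def prod.list_conv_set_nth lessThan_atLeast0)
qed

lemma minv_mat_diag:
  assumes "\<And>i. i < n \<Longrightarrow> d i \<noteq> 0"
  shows "minv (mat_diag n d) = mat_diag n (\<lambda>i. inverse (d i))"
  by (rule minv_unique[of _ n]) (use assms in \<open>auto intro!: mat_diag_cong simp flip: mat_diag_one\<close>)

text \<open>The characteristic polynomial of a triangular matrix splits into linear factors given by
  the diagonal, so ordered eigenvalues become a sorting problem.\<close>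

lemma real_eigvals_rdiag: "real_eigvals (rdiag n a) = sort (map a [0..<n])"
proof -
  have "diag_mat (rdiag n a) = map (\<lambda>i. complex_of_real (a i)) [0..<n]"
    by (auto simp: diag_mat_def mat_diag_def)
  then have "char_poly (rdiag n a) = (\<Prod>i\<leftarrow>[0..<n]. [:- complex_of_real (a i), 1:])"
    using char_poly_upper_triangular[of "rdiag n a" n]
    by (simp add: mat_diag_def upper_triangular_def o_def)
  moreover have "proots (\<Prod>i\<leftarrow>xs. [:- complex_of_real (a i), 1:]) =
      mset (map (\<lambda>i. complex_of_real (a i)) xs)" for xs
  proof (induction xs)
    case (Cons x xs)
    have "(\<Prod>i\<leftarrow>xs. [:- complex_of_real (a i), 1:]) \<noteq> 0"
      by (auto simp: prod_list_zero_iff)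
    with Cons show ?case
      by (simp add: proots_mult del: mult_pCons_left)
  qed simp
  ultimately show ?thesis
    by (simp add: real_eigvals_def image_mset.compositionality o_def flip: mset_map)
qed

section \<open>The positive semidefinite square root of a diagonal matrix\<close>

lemma rdiag_quadratic_form:
  assumes "v \<in> carrier_vec n"
  shows "(rdiag n a *\<^sub>v v) \<bullet>c v = complex_of_real (\<Sum>i<n. a i * (cmod (v $ i))\<^sup>2)"
proof -
  have "(rdiag n a *\<^sub>v v) $ i = complex_of_real (a i) * v $ i" if "i < n" for i
  proof -
    have "(rdiag n a *\<^sub>v v) $ i = (\<Sum>j\<in>{0..<n}. (if i = j then complex_of_real (a j) else 0) * v $ j)"
      using that assms by (simp add: mat_diag_def scalar_prod_def)
    then show ?thesis using that by (simp add: if_distrib[of "\<lambda>x. x * _"] cong: if_cong)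
  qed
  then show ?thesis
    using assms
    by (auto simp: scalar_prod_def lessThan_atLeast0 complex_norm_square mult.assoc
        simp del: of_real_power intro!: sum.cong)
qed

lemma psd_rdiag:
  assumes "\<And>i. i < n \<Longrightarrow> 0 \<le> a i"
  shows "psd (rdiag n a)"
proof -
  have "mat_adjoint (rdiag n a) = rdiag n a"
    using mat_adjoint_carrier[of "rdiag n a" n n]
    by (intro eq_matI) (auto simp: mat_adjoint_index mat_diag_def)
  moreover have "0 \<le> (rdiag n a *\<^sub>v v) \<bullet>c v" if "v \<in> carrier_vec n" for v
    using assms by (auto simp: rdiag_quadratic_form[OF that] less_eq_complex_def intro!: sum_nonneg)
  ultimately show ?thesis
    by (auto simp: psd_def mat_diag_def)
qed

text \<open>Since \<open>psd_sqrt\<close> is a definite description, the main work is to show that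
  no other positive semidefinite root exists, diagonal or not.\<close>

lemma psd_sqrt_rdiag:
  assumes l: "\<And>i. i < n \<Longrightarrow> 0 \<le> l i"
  shows "psd_sqrt (rdiag n l) = rdiag n (\<lambda>i. sqrt (l i))"
proof -
  let ?C = "rdiag n (\<lambda>i. sqrt (l i))"
  have C: "?C \<in> carrier_mat n n" by simp
  have CC: "?C * ?C = rdiag n l"
    using l by (auto intro!: mat_diag_cong simp flip: of_real_mult)
  \<comment> \<open>B commutes with \<open>B\<^sup>2\<close>, hence with C, so \<open>(B + C) (B - C) = 0\<close>. Positivity of B and C then
    forces the quadratic form of C to vanish on the columns of \<open>B - C\<close>.\<close>
  have unique: "B = ?C" if psdB: "psd B" and BB2: "B ^\<^sub>m 2 = rdiag n l" for B
  proof -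
    have B: "B \<in> carrier_mat n n"
    proof -
      have "dim_row (B ^\<^sub>m 2) = dim_row B" by simp
      then have "dim_row B = n" unfolding BB2 by (simp add: mat_diag_def)
      then show ?thesis using psdB by (auto simp: psd_def square_mat.simps)
    qed
    have BB: "B * B = rdiag n l" using BB2 pow_mat_two[OF B] by simp
    have herm: "B $$ (j, i) = cnj (B $$ (i, j))" if "i < n" "j < n" for i j
      using psdB B that mat_adjoint_index[of j B i] by (auto simp: psd_def)
    have BL: "B * rdiag n l = rdiag n l * B"
      unfolding BB[symmetric] using assoc_mult_mat[OF B B B] by simp
    have comm: "B $$ (i, j) * l j = l i * B $$ (i, j)" if "i < n" "j < n" for i j
      using arg_cong[OF BL, of "\<lambda>M. M $$ (i, j)"] that
      by (simp add: mat_diag_mult_left[OF B] mat_diag_mult_right[OF B])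
    \<comment> \<open>By \<open>comm\<close>, a nonzero entry \<open>B $$ (i, j)\<close> forces
      \<open>l i = l j\<close>, and then the two square roots agree as well.\<close>
    have "B * ?C = ?C * B"
    proof (rule eq_matI)
      fix i j assume "i < dim_row (?C * B)" "j < dim_col (?C * B)"
      then have ij: "i < n" "j < n" using B by (auto simp: mat_diag_def)
      show "(B * ?C) $$ (i, j) = (?C * B) $$ (i, j)"
        using comm[OF ij] ij
        by (cases "B $$ (i, j) = 0")
          (auto simp: mat_diag_mult_left[OF B] mat_diag_mult_right[OF B])
    qed (use B in \<open>auto simp: mat_diag_def\<close>)
    moreover have cancel: "X + Y - (Y + X) = 0\<^sub>m n n"
      if "X \<in> carrier_mat n n" "Y \<in> carrier_mat n n" for X Y :: "complex mat"
      using that by (intro eq_matI) auto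
    ultimately have BC: "(B + ?C) * (B - ?C) = 0\<^sub>m n n"
      using B C BB CC
      by (simp add: add_mult_distrib_mat[of _ n n _ _ n] mult_minus_distrib_mat[of _ n n _ n]
        cancel[OF mat_diag_dim mult_carrier_mat[OF C B]])
    have zero: "l i * (cmod ((B - ?C) $$ (i, j)))\<^sup>2 = 0" if "i < n" "j < n" for i j
    proof -
      let ?v = "col (B - ?C) j"
      have v: "?v \<in> carrier_vec n"
        using minus_carrier_mat[OF C, of B] col_dim[of "B - ?C" j] by (simp only: carrier_matD)
      have "(B + ?C) *\<^sub>v ?v = col ((B + ?C) * (B - ?C)) j"
        using B that minus_carrier_mat[OF C, of B] by (subst col_mult2[of _ n n _ n]) auto
      also have "\<dots> = 0\<^sub>v n" using BC that by simp
      finally have "B *\<^sub>v ?v + ?C *\<^sub>v ?v = 0\<^sub>v n"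
        using add_mult_distrib_mat_vec[OF B C v] by simp
      then have "(B *\<^sub>v ?v + ?C *\<^sub>v ?v) \<bullet>c ?v = 0"
        using v by simp
      then have "(B *\<^sub>v ?v) \<bullet>c ?v + (?C *\<^sub>v ?v) \<bullet>c ?v = 0"
        using v mult_mat_vec_carrier[OF B v] mult_mat_vec_carrier[OF C v]
        by (subst (asm) add_scalar_prod_distrib[of _ n]) auto
      moreover have "0 \<le> (B *\<^sub>v ?v) \<bullet>c ?v"
        using psdB B v by (auto simp: psd_def)
      moreover have "0 \<le> (\<Sum>i<n. sqrt (l i) * (cmod (?v $ i))\<^sup>2)"
        using l by (auto intro!: sum_nonneg)
      ultimately have "(\<Sum>i<n. sqrt (l i) * (cmod (?v $ i))\<^sup>2) = 0"
        unfolding rdiag_quadratic_form[OF v] less_eq_complex_def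
        by (auto simp: complex_eq_iff)
      then have "sqrt (l i) * (cmod (?v $ i))\<^sup>2 = 0"
        using l that by (subst (asm) sum_nonneg_eq_0_iff) auto
      then show ?thesis using B that by (auto simp: mat_diag_def)
    qed
    show "B = ?C"
    proof (rule eq_matI)
      fix i j assume "i < dim_row ?C" "j < dim_col ?C"
      then have ij: "i < n" "j < n" by (auto simp: mat_diag_def)
      show "B $$ (i, j) = ?C $$ (i, j)"
      proof (cases "l i = 0")
        case False
        then show ?thesis using zero[OF ij] ij B by (auto simp: mat_diag_def)
      next
        case True
        \<comment> \<open>Where \<open>l i = 0\<close>, the form of \<open>?C\<close> says nothing
          about row \<open>i\<close>. There the diagonal entry of \<open>B * B\<close> is the
          squared norm of that row, as \<open>B\<close> is Hermitian, so the row vanishes.\<close>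
        have "(B * B) $$ (i, i) = complex_of_real (\<Sum>k<n. (cmod (B $$ (i, k)))\<^sup>2)"
        proof -
          have "B $$ (i, k) * B $$ (k, i) = complex_of_real ((cmod (B $$ (i, k)))\<^sup>2)" if "k < n" for k
            unfolding herm[OF ij(1) that] complex_norm_square ..
          then show ?thesis
            using B ij by (simp add: scalar_prod_def lessThan_atLeast0 del: of_real_power)
        qed
        then have "(\<Sum>k<n. (cmod (B $$ (i, k)))\<^sup>2) = 0"
          using BB True ij by (simp add: mat_diag_def del: of_real_sum)
        then have "B $$ (i, j) = 0"
          using ij by (subst (asm) sum_nonneg_eq_0_iff) auto
        then show ?thesis using True ij by (auto simp: mat_diag_def)
      qed
    qed (use B in \<open>auto simp: mat_diag_def\<close>)
  qed
  show ?thesis unfolding psd_sqrt_def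
  proof (rule the_equality)
    show "psd ?C \<and> ?C ^\<^sub>m 2 = rdiag n l"
      using psd_rdiag[of n "\<lambda>i. sqrt (l i)"] l pow_mat_two[OF C] CC by auto
  qed (use unique in auto)
qed

section \<open>The key rate as a ratio of determinants\<close>

text \<open>With \<open>P = X * Y\<close>, factor \<open>1 - P^2 = (1 - P) * (1 + P)\<close> and
  apply Sylvester's identity to each factor. As \<open>Y * X = G * K = 1 - K\<close> with
  \<open>K\<close> the inverse of \<open>1 + G\<close>, the factors become \<open>K\<close> and
  \<open>(1 + 2 G) * K\<close>.\<close>

lemma det_resolvent_square:
  fixes S U V :: "complex mat"
  assumes S: "S \<in> carrier_mat n n" and U: "U \<in> carrier_mat n r" and V: "V \<in> carrier_mat r n"
    and G: "G = V * (S * S) * U" and nz: "det (1\<^sub>m r + G) \<noteq> 0"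
  shows "det (1\<^sub>m n - (S * U * minv (1\<^sub>m r + G) * V * S) ^\<^sub>m 2) =
    det (1\<^sub>m r + (G + G)) / (det (1\<^sub>m r + G))\<^sup>2"
proof -
  have Gc: "G \<in> carrier_mat r r" using S U V G by auto
  define K where "K = minv (1\<^sub>m r + G)"
  have GK: "(1\<^sub>m r + G) * K = 1\<^sub>m r" and K: "K \<in> carrier_mat r r"
    using minv_mult[of "1\<^sub>m r + G" r] Gc nz by (auto simp: K_def)
  have inv: "K + G * K = 1\<^sub>m r"
    using GK K Gc by (simp add: add_mult_distrib_mat[of _ r r _ _ r])
  \<comment> \<open>The inverse goes into \<open>X\<close>, so that \<open>S * S\<close> meets in
    the middle of \<open>Y * X\<close> and \<open>G\<close> appears.\<close>
  define X Y where "X = S * U * K" and "Y = V * S"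
  have X: "X \<in> carrier_mat n r" and Y: "Y \<in> carrier_mat r n"
    using S U V K by (auto simp: X_def Y_def)
  have P: "S * U * K * V * S = X * Y"
    using S U V K by (simp add: X_def Y_def assoc_mult_mat[of _ n r _ n _ n])
  have YX: "Y * X = G * K"
  proof -
    have "Y * X = V * (S * (S * (U * K)))"
      using S U V K by (simp add: X_def Y_def assoc_mult_mat[of _ r n _ n _ r] assoc_mult_mat[of _ n n _ r _ r])
    also have "\<dots> = G * K"
      using S U V K by (simp add: G assoc_mult_mat[of _ r n _ r _ r] assoc_mult_mat[of _ n n _ r _ r] assoc_mult_mat[of _ r n _ n _ r]
          assoc_mult_mat[of _ n n _ n _ r])
    finally show ?thesis .
  qed
  have XYc: "X * Y \<in> carrier_mat n n" using X Y by auto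
  have "1\<^sub>m n - (X * Y) ^\<^sub>m 2 = (1\<^sub>m n - X * Y) * (1\<^sub>m n + X * Y)"
  proof -
    have "A - B = A + C - (C + B)" if "A \<in> carrier_mat n n" "B \<in> carrier_mat n n" "C \<in> carrier_mat n n"
      for A B C :: "complex mat"
      using that by (intro eq_matI) auto
    from this[of "1\<^sub>m n" "X * Y * (X * Y)" "X * Y"] show ?thesis
      using XYc left_mult_one_mat[OF XYc] right_mult_one_mat[OF XYc]
      by (simp add: pow_mat_two minus_mult_distrib_mat[of _ n n _ _ n] mult_add_distrib_mat[of _ n n _ n])
  qed
  then have "det (1\<^sub>m n - (X * Y) ^\<^sub>m 2) = det (1\<^sub>m n - X * Y) * det (1\<^sub>m n + X * Y)"
    using det_mult[of "1\<^sub>m n - X * Y" n "1\<^sub>m n + X * Y"] XYc minus_carrier_mat[OF XYc] by simp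
  also have "1\<^sub>m n - X * Y = 1\<^sub>m n + (- X) * Y"
    using X Y by (intro eq_matI) auto
  also have "det \<dots> = det (1\<^sub>m r + Y * (- X))"
    by (rule det_one_plus_mult_comm) (use X Y in auto)
  also have "1\<^sub>m r + Y * (- X) = K"
  proof -
    have "Y * (- X) = - (G * K)" using X Y YX by auto
    moreover have "C + B + - B = C" if "B \<in> carrier_mat r r" "C \<in> carrier_mat r r"
      for B C :: "complex mat"
      using that by (intro eq_matI) auto
    from this[of "G * K" K] have "1\<^sub>m r + - (G * K) = K" using inv Gc K by simp
    ultimately show ?thesis by simp
  qed
  also have "det (1\<^sub>m n + X * Y) = det (1\<^sub>m r + Y * X)"
    by (rule det_one_plus_mult_comm[OF X Y])
  also have "1\<^sub>m r + Y * X = (1\<^sub>m r + (G + G)) * K"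
    using Gc K by (simp add: YX add_mult_distrib_mat[of _ r r _ _ r] assoc_add_mat[of _ r r, symmetric] inv)
  also have "det \<dots> = det (1\<^sub>m r + (G + G)) * det K"
    using Gc K by (intro det_mult) auto
  finally have *: "det (1\<^sub>m n - (X * Y) ^\<^sub>m 2) = det K * (det (1\<^sub>m r + (G + G)) * det K)" .
  have "det (1\<^sub>m r + G) * det K = 1"
    using det_mult[of "1\<^sub>m r + G" r K] GK Gc K by simp
  then have "det K = 1 / det (1\<^sub>m r + G)"
    using nz by (simp add: field_simps)
  with * show ?thesis
    unfolding P[symmetric] K_def by (simp add: power2_eq_square)
qed

lemma row_minor_adjoint:
  assumes U: "U \<in> carrier_mat n r" and f: "f \<in> index_funs r n"
  shows "row_minor (transpose_mat (mat_adjoint U)) f = cnj (row_minor U f)"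
proof -
  have "mat r r (\<lambda>(i, j). transpose_mat (mat_adjoint U) $$ (f i, j)) =
      mat r r (\<lambda>(i, j). cnj (U $$ (f i, j)))"
    using U f mat_adjoint_carrier[OF U]
    by (intro eq_matI) (auto simp: index_funs_def mat_adjoint_index)
  moreover have "det (mat r r (\<lambda>(i, j). cnj (U $$ (f i, j)))) =
      cnj (det (mat r r (\<lambda>(i, j). U $$ (f i, j))))"
    by (auto simp: det_def'[of _ r] permutes_in_image intro!: sum.cong prod.cong)
  ultimately show ?thesis
    using U mat_adjoint_carrier[OF U] by (simp add: row_minor_def)
qed

text \<open>The weight of an r-element row set is shared equally among the \<open>r!\<close>
  injective index functions with that image.\<close>

definition minor_weight :: "complex mat \<Rightarrow> nat \<Rightarrow> (nat \<Rightarrow> nat) \<Rightarrow> real" where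
  "minor_weight U r f = (cmod (row_minor U f))\<^sup>2 / fact r"

text \<open>The two minors in Cauchy--Binet are conjugate here, so their product is a squared
  modulus and independent of \<open>d\<close>.\<close>

lemma det_compression:
  assumes U: "U \<in> carrier_mat n r"
  shows "det (mat_adjoint U * rdiag n d * U) =
    complex_of_real (\<Sum>f\<in>index_funs r n. minor_weight U r f * (\<Prod>i<r. d (f i)))"
proof -
  have "of_nat (fact r) * det (mat_adjoint U * rdiag n d * U) =
      (\<Sum>f\<in>index_funs r n. complex_of_real (fact r * (minor_weight U r f * (\<Prod>i<r. d (f i)))))"
    unfolding cauchy_binet_diag[OF mat_adjoint_carrier[OF U] U]
    by (rule sum.cong)
      (auto simp: row_minor_adjoint[OF U] minor_weight_def complex_norm_square mult_ac simp del: of_real_power)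
  then show ?thesis by (simp flip: sum_distrib_left)
qed

lemma sum_minor_weight:
  assumes U: "U \<in> carrier_mat n r" and iso: "mat_adjoint U * U = 1\<^sub>m r"
  shows "(\<Sum>f\<in>index_funs r n. minor_weight U r f) = 1"
  using det_compression[OF U, of "\<lambda>_. 1"] iso mat_adjoint_carrier[OF U]
  by (simp del: of_real_sum)

text \<open>For an isometry the identity is itself the compression \<open>mat_adjoint U * U\<close>,
  so it can be absorbed into the diagonal.\<close>

lemma compression_add:
  assumes U: "U \<in> carrier_mat n r" and iso: "mat_adjoint U * U = 1\<^sub>m r"
  shows "1\<^sub>m r + mat_adjoint U * rdiag n a * U = mat_adjoint U * rdiag n (\<lambda>i. 1 + a i) * U"
proof -
  have "rdiag n (\<lambda>i. 1 + a i) = 1\<^sub>m n + rdiag n a"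
    by (simp add: mat_diag_add flip: mat_diag_one)
  then show ?thesis
    using mat_adjoint_carrier[OF U] U iso
    by (simp add: mult_add_distrib_mat[of _ r n _ n] add_mult_distrib_mat[of _ r n _ _ r])
qed

lemma key_rate_isometry:
  assumes l: "\<And>i. i < n \<Longrightarrow> 0 \<le> l i"
    and U: "U \<in> carrier_mat n r" and iso: "mat_adjoint U * U = 1\<^sub>m r"
    and nz: "det (mat_adjoint U * rdiag n (\<lambda>i. 1 + l i) * U) \<noteq> 0"
  shows "key_rate b (rdiag n l) U =
    - log b (Re (det (mat_adjoint U * rdiag n (\<lambda>i. 1 + 2 * l i) * U) /
        (det (mat_adjoint U * rdiag n (\<lambda>i. 1 + l i) * U))\<^sup>2))"
proof -
  let ?S = "rdiag n (\<lambda>i. sqrt (l i))"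
  let ?G = "mat_adjoint U * rdiag n l * U"
  have SS: "?S * ?S = rdiag n l"
    using l by (auto intro!: mat_diag_cong simp flip: of_real_mult)
  have "?G + ?G = mat_adjoint U * rdiag n (\<lambda>i. 2 * l i) * U"
  proof -
    have "rdiag n (\<lambda>i. 2 * l i) = rdiag n l + rdiag n l"
      by (auto simp: mat_diag_add intro!: mat_diag_cong)
    then show ?thesis
      using mat_adjoint_carrier[OF U] U
      by (simp add: mult_add_distrib_mat[of _ r n _ n] add_mult_distrib_mat[of _ r n _ _ r])
  qed
  then have "1\<^sub>m r + (?G + ?G) = mat_adjoint U * rdiag n (\<lambda>i. 1 + 2 * l i) * U"
    using compression_add[OF U iso, of "\<lambda>i. 2 * l i"] by simp
  moreover have "det (1\<^sub>m n - (?S * U * minv (1\<^sub>m r + ?G) * mat_adjoint U * ?S) ^\<^sub>m 2) =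
      det (1\<^sub>m r + (?G + ?G)) / (det (1\<^sub>m r + ?G))\<^sup>2"
    by (rule det_resolvent_square[of _ n])
      (use U mat_adjoint_carrier[OF U] nz SS compression_add[OF U iso, of l] in auto)
  moreover have "dim_row (rdiag n l) = n" by (simp add: mat_diag_def)
  ultimately show ?thesis
    using U by (simp add: key_rate_def Let_def psd_sqrt_rdiag[OF l] compression_add[OF U iso])
qed

section \<open>The lower bound by convexity\<close>

text \<open>The variance about the weighted mean \<open>m\<close> is nonnegative.\<close>

lemma weighted_sum_square_le:
  fixes w a :: "'a \<Rightarrow> real"
  assumes "\<And>x. x \<in> A \<Longrightarrow> 0 \<le> w x" and "(\<Sum>x\<in>A. w x) = 1"
  shows "(\<Sum>x\<in>A. w x * a x)\<^sup>2 \<le> (\<Sum>x\<in>A. w x * (a x)\<^sup>2)"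
proof -
  define m where "m = (\<Sum>x\<in>A. w x * a x)"
  have "0 \<le> (\<Sum>x\<in>A. w x * (a x - m)\<^sup>2)"
    using assms(1) by (auto intro!: sum_nonneg)
  also have "\<dots> = (\<Sum>x\<in>A. w x * (a x)\<^sup>2 - 2 * m * (w x * a x) + m\<^sup>2 * w x)"
    by (intro sum.cong) (auto simp: power2_eq_square algebra_simps)
  also have "\<dots> = (\<Sum>x\<in>A. w x * (a x)\<^sup>2) - 2 * m * m + m\<^sup>2"
    using assms(2) by (simp add: sum.distrib sum_subtractf m_def flip: sum_distrib_left)
  finally show ?thesis by (simp add: m_def power2_eq_square)
qed

text \<open>The constant \<open>c\<close> is any nonnegative bound valid for all injective
  selections, which separates convexity from the search for the smallest product. The first
  conclusion makes the ratio meaningful and feeds \<open>key_rate_isometry\<close>.\<close>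

lemma det_ratio_lower_bound:
  assumes l: "\<And>i. i < n \<Longrightarrow> 0 \<le> l i"
    and U: "U \<in> carrier_mat n r" and iso: "mat_adjoint U * U = 1\<^sub>m r"
    and c0: "0 \<le> c"
    and c: "\<And>f. f \<in> {..<r} \<rightarrow> {..<n} \<Longrightarrow> inj_on f {..<r} \<Longrightarrow>
      c \<le> (\<Prod>i<r. (1 + 2 * l (f i)) / (1 + l (f i))\<^sup>2)"
  shows "det (mat_adjoint U * rdiag n (\<lambda>i. 1 + l i) * U) \<noteq> 0"
    and "c \<le> Re (det (mat_adjoint U * rdiag n (\<lambda>i. 1 + 2 * l i) * U) /
        (det (mat_adjoint U * rdiag n (\<lambda>i. 1 + l i) * U))\<^sup>2)"
proof -
  let ?F = "index_funs r n" and ?w = "minor_weight U r"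
  let ?a = "\<lambda>f. \<Prod>i<r. 1 + l (f i)" and ?b = "\<lambda>f. \<Prod>i<r. 1 + 2 * l (f i)"
  let ?A = "\<Sum>f\<in>?F. ?w f * ?a f" and ?B = "\<Sum>f\<in>?F. ?w f * ?b f"
  have w: "0 \<le> ?w f" for f by (simp add: minor_weight_def)
  have lf: "0 \<le> l (f i)" if "f \<in> ?F" "i < r" for f i
    using that l by (auto simp: index_funs_def)
  \<comment> \<open>All factors \<open>1 + l (f i)\<close> are at least 1 and the weights sum to 1.
    Hence division by the square of \<open>?A\<close> is legitimate.\<close>
  have "1 \<le> ?A"
  proof -
    have "?w f \<le> ?w f * ?a f" if "f \<in> ?F" for f
    proof -
      have "1 \<le> ?a f" using lf[OF that] by (intro prod_ge_1) auto
      then show ?thesis using mult_left_mono[of 1 "?a f" "?w f"] w[of f] by simp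
    qed
    then show ?thesis using sum_mono[of ?F ?w "\<lambda>f. ?w f * ?a f"] sum_minor_weight[OF U iso] by simp
  qed
  have "c * ?A\<^sup>2 \<le> ?B"
  proof -
    have "c * ?A\<^sup>2 \<le> c * (\<Sum>f\<in>?F. ?w f * (?a f)\<^sup>2)"
      using c0 w sum_minor_weight[OF U iso] by (intro mult_left_mono weighted_sum_square_le) auto
    also have "\<dots> = (\<Sum>f\<in>?F. ?w f * (c * (?a f)\<^sup>2))"
      by (simp add: sum_distrib_left mult_ac)
    also have "\<dots> \<le> ?B"
    proof (rule sum_mono)
      fix f assume f: "f \<in> ?F"
      show "?w f * (c * (?a f)\<^sup>2) \<le> ?w f * ?b f"
      proof (cases "inj_on f {0..<r}")
        \<comment> \<open>The bound \<open>c\<close> covers injective \<open>f\<close> only; for the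
          others the weight is zero.\<close>
        case False
        then show ?thesis by (simp add: minor_weight_def row_minor_not_inj[OF U])
      next
        case True
        have "c \<le> (\<Prod>i<r. (1 + 2 * l (f i)) / (1 + l (f i))\<^sup>2)"
          by (rule c) (use True f in \<open>auto simp: index_funs_def lessThan_atLeast0\<close>)
        also have "\<dots> = ?b f / (?a f)\<^sup>2"
          by (simp add: prod_dividef prod_power_distrib)
        finally have "c \<le> ?b f / (?a f)\<^sup>2" .
        moreover have "0 < ?a f"
          using lf[OF f] by (auto intro!: prod_pos add_pos_nonneg)
        ultimately have "c * (?a f)\<^sup>2 \<le> ?b f"
          using pos_le_divide_eq[of "(?a f)\<^sup>2" c "?b f"] zero_less_power by blast
        then show ?thesis by (intro mult_left_mono w)
      qed
    qed
    finally show ?thesis .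
  qed
  moreover have "0 < ?A\<^sup>2"
    using \<open>1 \<le> ?A\<close> by (intro zero_less_power) linarith
  ultimately have "c \<le> ?B / ?A\<^sup>2"
    by (simp only: pos_le_divide_eq)
  moreover have "complex_of_real p / (complex_of_real q)\<^sup>2 = complex_of_real (p / q\<^sup>2)" for p q
    by simp
  ultimately show "c \<le> Re (det (mat_adjoint U * rdiag n (\<lambda>i. 1 + 2 * l i) * U) /
        (det (mat_adjoint U * rdiag n (\<lambda>i. 1 + l i) * U))\<^sup>2)"
    unfolding det_compression[OF U] by (simp only: Re_complex_of_real)
  show "det (mat_adjoint U * rdiag n (\<lambda>i. 1 + l i) * U) \<noteq> 0"
    unfolding det_compression[OF U] of_real_eq_0_iff using \<open>1 \<le> ?A\<close> by linarith
qed

section \<open>Compression to selected coordinates\<close>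

lemma unit_cols_carrier: "unit_cols n r \<eta> \<in> carrier_mat n r"
  by (auto simp: unit_cols_def)

lemma unit_cols_index:
  assumes "i < n" "j < r" "\<eta> j < n"
  shows "unit_cols n r \<eta> $$ (i, j) = (if i = \<eta> j then 1 else 0)"
  using assms by (simp add: unit_cols_def mat_of_cols_index)

text \<open>Only the index \<open>k = \<eta> i = \<eta> j\<close> contributes to entry
  \<open>(i, j)\<close>, and injectivity rules this out off the diagonal. With \<open>d = 1\<close>
  it shows that the selection is an isometry.\<close>

lemma unit_cols_compression:
  assumes \<eta>: "\<And>i. i < r \<Longrightarrow> \<eta> i < n" and inj: "inj_on \<eta> {..<r}"
  shows "mat_adjoint (unit_cols n r \<eta>) * mat_diag n d * unit_cols n r \<eta> = mat_diag r (\<lambda>i. d (\<eta> i))"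
proof -
  let ?U = "unit_cols n r \<eta>"
  note U = unit_cols_carrier[of n r \<eta>]
  note UH = mat_adjoint_carrier[OF U]
  have "(mat_adjoint ?U * mat_diag n d * ?U) $$ (i, j) = mat_diag r (\<lambda>i. d (\<eta> i)) $$ (i, j)"
    if ij: "i < r" "j < r" for i j
  proof -
    have "(mat_adjoint ?U * mat_diag n d * ?U) $$ (i, j) =
        (\<Sum>k\<in>{0..<n}. mat_adjoint ?U $$ (i, k) * d k * ?U $$ (k, j))"
      using ij U UH by (simp add: mat_diag_mult_right[OF UH] scalar_prod_def)
    also have "\<dots> = (\<Sum>k\<in>{0..<n}. if k = \<eta> i then (if \<eta> i = \<eta> j then d k else 0) else 0)"
      using ij U \<eta> by (intro sum.cong) (auto simp: mat_adjoint_index unit_cols_index)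
    also have "\<dots> = (if \<eta> i = \<eta> j then d (\<eta> i) else 0)"
      using ij \<eta> by simp
    also have "\<dots> = mat_diag r (\<lambda>i. d (\<eta> i)) $$ (i, j)"
      using ij inj by (auto simp: mat_diag_def inj_on_def)
    finally show ?thesis .
  qed
  then show ?thesis using U UH by (intro eq_matI) (auto simp: mat_diag_def)
qed

section \<open>Smallest products and order reversal\<close>

text \<open>Induction adds a new maximum \<open>m\<close> to \<open>F\<close>. As \<open>F\<close>
  lies below \<open>m\<close>, its size is at most \<open>m\<close>, so the next prefix entry is at
  most \<open>zs ! m\<close>; nonnegativity allows multiplying the inequalities.\<close>

lemma prod_sorted_prefix_le:
  fixes zs :: "real list"
  assumes "sorted zs" and "\<And>z. z \<in> set zs \<Longrightarrow> 0 \<le> z"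
    and "finite F" and "F \<subseteq> {..<length zs}"
  shows "(\<Prod>i<card F. zs ! i) \<le> (\<Prod>k\<in>F. zs ! k)"
  using assms(3,4)
proof (induction F rule: finite_linorder_max_induct)
  case (insert m F)
  have "card F \<le> m"
    using card_mono[of "{..<m}" F] insert by auto
  then have "zs ! card F \<le> zs ! m"
    using insert assms(1) by (intro sorted_nth_mono) auto
  moreover have "0 \<le> zs ! i" if "i \<le> m" for i
    using assms(2) insert that by auto
  moreover have "0 \<le> (\<Prod>k\<in>F. zs ! k)" "0 \<le> (\<Prod>i<card F. zs ! i)"
    using assms(2) insert \<open>card F \<le> m\<close> by (auto intro!: prod_nonneg)
  moreover have "m \<notin> F" using insert by auto
  ultimately show ?case
    using insert \<open>card F \<le> m\<close> by (simp add: mult.commute) (intro mult_mono, auto)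
qed simp

text \<open>The sorting permutation \<open>p\<close> turns the selection \<open>f\<close> into a set
  of \<open>r\<close> distinct positions of the sorted list, to which the prefix bound
  applies.\<close>

lemma prod_smallest_le:
  fixes y :: "nat \<Rightarrow> real"
  assumes y: "\<And>i. i < n \<Longrightarrow> 0 \<le> y i"
    and f: "f \<in> {..<r} \<rightarrow> {..<n}" and inj: "inj_on f {..<r}"
  shows "(\<Prod>i<r. sort (map y [0..<n]) ! i) \<le> (\<Prod>i<r. y (f i))"
proof -
  let ?ys = "map y [0..<n]"
  have "mset ?ys = mset (sort ?ys)" by simp
  then obtain p where p: "p permutes {..<length (sort ?ys)}" and ps: "permute_list p (sort ?ys) = ?ys"
    by (rule mset_eq_permutation)
  have p': "p permutes {..<n}" using p by simp
  have yp: "y i = sort ?ys ! p i" if "i < n" for i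
    using permute_list_nth[OF p, of i] ps that by simp
  let ?F = "(\<lambda>i. p (f i)) ` {..<r}"
  have inj': "inj_on (\<lambda>i. p (f i)) {..<r}"
    using inj inj_eq[OF permutes_inj[OF p']] by (simp add: inj_on_def)
  have "(\<Prod>i<card ?F. sort ?ys ! i) \<le> (\<Prod>k\<in>?F. sort ?ys ! k)"
  proof (rule prod_sorted_prefix_le)
    show "?F \<subseteq> {..<length (sort ?ys)}"
      using f permutes_in_image[OF p'] by fastforce
  qed (use y in auto)
  also have "\<dots> = (\<Prod>i<r. sort ?ys ! p (f i))"
    by (simp add: prod.reindex[OF inj'])
  also have "\<dots> = (\<Prod>i<r. y (f i))"
    using f by (intro prod.cong refl yp[symmetric]) auto
  finally show ?thesis by (simp add: card_image[OF inj'])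
qed

text \<open>Needed to pass from the largest eigenvalues that define \<open>\<eta>\<close> to the
  smallest ones in the optimal rate.\<close>

lemma sort_map_antimono:
  fixes h :: "real \<Rightarrow> real"
  assumes h: "\<And>s t. s \<in> set xs \<Longrightarrow> t \<in> set xs \<Longrightarrow> s \<le> t \<Longrightarrow> h t \<le> h s"
  shows "sort (map h xs) = map h (rev (sort xs))"
proof (rule properties_for_sort)
  have "sorted_wrt (\<lambda>s t. h t \<le> h s) (sort xs)"
    by (rule sorted_wrt_mono_rel[OF _ sorted_sort]) (use h in auto)
  then show "sorted (map h (rev (sort xs)))"
    by (simp only: sorted_map sorted_wrt_rev)
qed simp

section \<open>Optimality of the coordinate selection and the value of the rate\<close>

theorem theorem2:
  fixes M N Me Ne :: nat and \<Lambda> :: "complex mat" and \<eta> :: "nat \<Rightarrow> nat" and b :: real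
  assumes "b > 1"
    and "Me > 0" and "Ne > 0" and "Me * Ne \<le> M * N"
    and "\<Lambda> \<in> carrier_mat (M * N) (M * N)"
    and "diagonal_mat \<Lambda>"
    and "\<forall>i < M * N. \<Lambda> $$ (i, i) \<in> \<real>\<^sub>\<ge>\<^sub>0"
    and "inj_on \<eta> {..<Me * Ne}"
    and "\<forall>i < Me * Ne. \<eta> i < M * N \<and>
           (\<Lambda> * minv (1\<^sub>m (M * N) + \<Lambda>)) $$ (\<eta> i, \<eta> i) =
             complex_of_real (nth_largest_eigval (\<Lambda> * minv (1\<^sub>m (M * N) + \<Lambda>)) i)"
  shows "is_arg_max (key_rate b \<Lambda>)
           (\<lambda>U. U \<in> carrier_mat (M * N) (Me * Ne) \<and> mat_adjoint U * U = 1\<^sub>m (Me * Ne))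
           (unit_cols (M * N) (Me * Ne) \<eta>)
    \<and> key_rate b \<Lambda> (unit_cols (M * N) (Me * Ne) \<eta>) =
           - (\<Sum>i < Me * Ne. log b (nth_smallest_eigval
               (1\<^sub>m (M * N) - \<Lambda> ^\<^sub>m 2 * (minv (1\<^sub>m (M * N) + \<Lambda>)) ^\<^sub>m 2) i))
    \<and> (\<forall>i < Me * Ne.
           complex_of_real (nth_smallest_eigval
               (1\<^sub>m (M * N) - \<Lambda> ^\<^sub>m 2 * (minv (1\<^sub>m (M * N) + \<Lambda>)) ^\<^sub>m 2) i) =
           (1\<^sub>m (M * N) - \<Lambda> ^\<^sub>m 2 * (minv (1\<^sub>m (M * N) + \<Lambda>)) ^\<^sub>m 2) $$ (\<eta> i, \<eta> i))"
proof -
  define n r where "n = M * N" and "r = Me * Ne"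
  note nr = n_def[symmetric] r_def[symmetric]
  define l where "l i = Re (\<Lambda> $$ (i, i))" for i
  \<comment> \<open>These are the diagonals of the two matrices whose eigenvalues occur in the
    claim; \<open>y\<close> is also the factor in the determinant ratio, and the link is
    \<open>y = 1 - x^2\<close>.\<close>
  define x y where "x i = l i / (1 + l i)" and "y i = (1 + 2 * l i) / (1 + l i)\<^sup>2" for i
  have "r \<le> n" using assms(4) by (simp add: n_def r_def)
  have l: "0 \<le> l i" and \<Lambda>_ii: "\<Lambda> $$ (i, i) = complex_of_real (l i)" if "i < n" for i
    using assms(7) that by (auto simp: l_def n_def complex_nonneg_Reals_iff complex_eq_iff)
  have \<Lambda>: "\<Lambda> = rdiag n l"
    using assms(5,6) \<Lambda>_ii by (intro eq_matI) (auto simp: mat_diag_def diagonal_mat_def n_def)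
  have yx: "y i = 1 - (x i)\<^sup>2" if "i < n" for i
    using l[OF that] by (simp add: x_def y_def power_divide divide_simps)
      (simp add: power2_eq_square algebra_simps)
  have y_pos: "0 < y i" if "i < n" for i
    using l[OF that] by (auto simp: y_def intro!: divide_pos_pos)
  have x_nonneg: "0 \<le> x i" if "i < n" for i
    using l[OF that] by (simp add: x_def)
  have "1\<^sub>m n + \<Lambda> = rdiag n (\<lambda>i. 1 + l i)"
    by (simp add: \<Lambda> mat_diag_add flip: mat_diag_one)
  moreover have "complex_of_real (1 + l i) \<noteq> 0" if "i < n" for i
    unfolding of_real_eq_0_iff using l[OF that] by linarith
  ultimately have minv: "minv (1\<^sub>m n + \<Lambda>) = mat_diag n (\<lambda>i. inverse (complex_of_real (1 + l i)))"
    by (simp add: minv_mat_diag)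
  have X: "\<Lambda> * minv (1\<^sub>m n + \<Lambda>) = rdiag n x"
    unfolding minv by (simp add: \<Lambda> x_def divide_inverse)
  have Y: "1\<^sub>m n - \<Lambda> ^\<^sub>m 2 * minv (1\<^sub>m n + \<Lambda>) ^\<^sub>m 2 = rdiag n y"
  proof -
    have "1\<^sub>m n - \<Lambda> ^\<^sub>m 2 * minv (1\<^sub>m n + \<Lambda>) ^\<^sub>m 2 = rdiag n (\<lambda>i. 1 - (x i)\<^sup>2)"
      unfolding minv
      by (simp add: \<Lambda> x_def pow_mat_two[OF mat_diag_dim] mat_diag_minus divide_inverse
          power2_eq_square mult_ac flip: mat_diag_one)
    also have "\<dots> = rdiag n y" using yx by (intro mat_diag_cong) simp
    finally show ?thesis .
  qed
  have \<eta>: "\<eta> i < n" and \<eta>_eig: "x (\<eta> i) = rev (sort (map x [0..<n])) ! i" if "i < r" for i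
    using assms(9) that unfolding nr X nth_largest_eigval_def real_eigvals_rdiag
    by (auto simp: mat_diag_def)
  have inj: "inj_on \<eta> {..<r}" using assms(8) by (simp add: r_def)
  \<comment> \<open>On nonnegative reals \<open>1 - t^2\<close> reverses the order, so the i-th
    largest \<open>x\<close> yields the i-th smallest \<open>y\<close>. Only values are compared, so
    ties do no harm.\<close>
  have y_eig: "sort (map y [0..<n]) ! i = y (\<eta> i)" if "i < r" for i
  proof -
    have "sort (map y [0..<n]) = sort (map (\<lambda>t. 1 - t\<^sup>2) (map x [0..<n]))"
      using yx by (intro arg_cong[where f = sort]) simp
    also have "\<dots> = map (\<lambda>t. 1 - t\<^sup>2) (rev (sort (map x [0..<n])))"
    proof (rule sort_map_antimono)
      fix s t assume "s \<in> set (map x [0..<n])" "s \<le> t"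
      then show "1 - t\<^sup>2 \<le> 1 - s\<^sup>2" using x_nonneg by (auto intro!: power_mono)
    qed
    also have "\<dots> ! i = 1 - (rev (sort (map x [0..<n])) ! i)\<^sup>2"
      using that \<open>r \<le> n\<close> by (intro nth_map) simp
    also have "\<dots> = y (\<eta> i)"
      by (simp only: \<eta>_eig[OF that] yx[OF \<eta>[OF that]])
    finally show ?thesis .
  qed
  \<comment> \<open>By \<open>y_eig\<close> this is the product of the \<open>r\<close> smallest
    values of \<open>y\<close>, hence a bound for every injective selection.\<close>
  define c where "c = (\<Prod>i<r. y (\<eta> i))"
  have "0 < c" using y_pos \<eta> by (auto simp: c_def intro!: prod_pos)
  have c_le: "c \<le> (\<Prod>i<r. (1 + 2 * l (f i)) / (1 + l (f i))\<^sup>2)"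
    if "f \<in> {..<r} \<rightarrow> {..<n}" "inj_on f {..<r}" for f
  proof -
    have "c = (\<Prod>i<r. sort (map y [0..<n]) ! i)"
      unfolding c_def by (rule prod.cong[OF refl y_eig[symmetric]]) simp
    also have "\<dots> \<le> (\<Prod>i<r. y (f i))"
      by (rule prod_smallest_le[OF less_imp_le[OF y_pos] that])
    finally show ?thesis unfolding y_def .
  qed
  let ?U = "unit_cols n r \<eta>"
  note U = unit_cols_carrier[of n r \<eta>]
  have iso: "mat_adjoint ?U * ?U = 1\<^sub>m r"
    using unit_cols_compression[OF \<eta> inj, of "\<lambda>_. 1"] mat_adjoint_carrier[OF U] by simp
  have
    det_nz: "det (mat_adjoint V * rdiag n (\<lambda>i. 1 + l i) * V) \<noteq> 0" and
    ratio: "c \<le> Re (det (mat_adjoint V * rdiag n (\<lambda>i. 1 + 2 * l i) * V) /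
      (det (mat_adjoint V * rdiag n (\<lambda>i. 1 + l i) * V))\<^sup>2)"
    if "V \<in> carrier_mat n r" "mat_adjoint V * V = 1\<^sub>m r" for V
    by (rule det_ratio_lower_bound[where l = l and n = n, OF l that less_imp_le[OF \<open>0 < c\<close>] c_le];
        assumption)+
  have rate_eq: "key_rate b \<Lambda> V =
      - log b (Re (det (mat_adjoint V * rdiag n (\<lambda>i. 1 + 2 * l i) * V) /
        (det (mat_adjoint V * rdiag n (\<lambda>i. 1 + l i) * V))\<^sup>2))"
    if V: "V \<in> carrier_mat n r" "mat_adjoint V * V = 1\<^sub>m r" for V
    unfolding \<Lambda> using l V det_nz[OF V] by (rule key_rate_isometry)
  \<comment> \<open>For the selected columns both compressions are diagonal, so the ratio of
    determinants equals \<open>c\<close> and the bound is attained.\<close>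
  have rate: "key_rate b \<Lambda> ?U = - log b c"
  proof -
    have "det (mat_diag r (\<lambda>i. complex_of_real (1 + 2 * l (\<eta> i)))) /
        (det (mat_diag r (\<lambda>i. complex_of_real (1 + l (\<eta> i)))))\<^sup>2 = complex_of_real c"
      by (simp add: det_mat_diag c_def y_def prod_dividef prod_power_distrib)
    then show ?thesis
      by (simp only: rate_eq[OF U iso] unit_cols_compression[OF \<eta> inj] Re_complex_of_real)
  qed
  \<comment> \<open>A ratio of at least \<open>c > 0\<close> gives a rate of at most
    \<open>- log b c\<close>, because the logarithm is increasing for \<open>b > 1\<close>.\<close>
  have opt: "key_rate b \<Lambda> V \<le> - log b c"
    if V: "V \<in> carrier_mat n r" "mat_adjoint V * V = 1\<^sub>m r" for V
    unfolding rate_eq[OF V] neg_le_iff_le using assms(1) \<open>0 < c\<close> ratio[OF V] by (rule log_mono)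
  have "is_arg_max (key_rate b \<Lambda>)
      (\<lambda>U. U \<in> carrier_mat n r \<and> mat_adjoint U * U = 1\<^sub>m r) ?U"
    unfolding is_arg_max_def rate using U iso opt by (auto simp: not_less)
  moreover have "log b c = (\<Sum>i<r. log b (y (\<eta> i)))"
  proof -
    have "ln c = (\<Sum>i<r. ln (y (\<eta> i)))"
      unfolding c_def using y_pos[OF \<eta>] by (intro ln_prod) (auto simp: less_imp_neq[symmetric])
    then show ?thesis by (simp add: log_def sum_divide_distrib)
  qed
  ultimately show ?thesis
    unfolding nr Y nth_smallest_eigval_def real_eigvals_rdiag
    using rate y_eig \<eta> by (auto simp: mat_diag_def)
qed

end
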